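(* Let $\alpha$ be a unit speed spacelike curve in $\mathbf{E}_1^3$ with timelike binormal, curvature $\kappa>0$ and torsion $\tau$, and with spacelike Darboux vector $\omega=\tau t-\kappa b$ (i.e. $|\kappa|<|\tau|$). Let $\alpha^*$ be an involute of $\alpha$ and let $\alpha^*_{t^*}=t^*$ be its tangent spherical indicatrix, parametrized by its own arc length. If $\alpha$ is a general helix, then $\alpha^*_{t^*}$ is a geodesic on the Lorentzian sphere $S_1^2$, and the natural lift $\overline{\alpha^*}_{t^*}$ of $\alpha^*_{t^*}$ is an integral curve of the geodesic spray on the tangent bundle $T(S_1^2)$. The same conclusion holds when $\omega$ is timelike (i.e. $|\kappa|>|\tau|$) instead of spacelike.
   Context: $\mathbf{E}_1^3$ is $\mathbb{R}^3$ with the metric $g=-dx_1^2+dx_2^2+dx_3^2$; $D$ is its standard flat connection, and $\|a\|=\sqrt{|g(a,a)|}$. A vector $v$ is spacelike if $g(v,v)>0$ or $v=0$, and timelike if $g(v,v)<0$. $S_1^2=\{a: g(a,a)=1\}$ is the Lorentzian unit sphere. A unit speed spacelike curve $\alpha$ with timelike binormal has a Frenet frame $\{t,n,b\}$ of mutually orthogonal vectors along $\alpha$ with $t=\alpha'$, $g(t,t)=g(n,n)=1$, $g(b,b)=-1$, satisfying $t'=\kappa n$, $n'=-\kappa t+\tau b$, $b'=\tau n$. It is a general helix if $\tau/\kappa$ is constant. An involute of $\alpha$ (parametrized by the arc length $s$ of $\alpha$) is $\alpha^*(s)=\alpha(s)+(c-s)t(s)$, where $c$ is a real constant and $s<c$;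 its unit tangent vector is $t^*=n$. The tangent spherical indicatrix of $\alpha^*$ is the curve traced on $S_1^2$ by the vector $t^*$ translated to the origin. Let $M$ be a nondegenerate hypersurface of $\mathbf{E}_1^3$ with unit normal field $\xi$, $\varepsilon=g(\xi,\xi)$, and shape operator $S(v)=-D_v\xi$ (for $S_1^2$, $\xi$ is the position vector). The natural lift of a curve $\beta$ on $M$ is the curve $\overline\beta(s)=(\beta(s),\beta'(s))=\beta'(s)|_{\beta(s)}$ in $TM$, and one writes $\frac{d\overline\beta}{ds}=D_{\beta'}\beta'$. The geodesic spray is $X(v)=\varepsilon\, g(v,S(v))\,\xi$ (with $\xi$ evaluated at the base point of $v\in TM$). The natural lift $\overline\beta$ is an integral curve of $X$ if $D_{\beta'}\beta'=X(\beta')$ along $\beta$. A curve $\beta$ on $M$ is a geodesic if $\overline{D}_{\beta'}\beta'=0$, with $\overline{D}$ the induced Levi-Civita connection of $M$. *)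

theory Defs
  imports "HOL-Analysis.Analysis"
begin

section \<open>Minkowski 3-space\<close>

definition lorentz :: "real^3 \<Rightarrow> real^3 \<Rightarrow> real" where
  "lorentz a b = - (a $ 1) * (b $ 1) + (a $ 2) * (b $ 2) + (a $ 3) * (b $ 3)"

definition lorentz_norm :: "real^3 \<Rightarrow> real" where
  "lorentz_norm a = sqrt \<bar>lorentz a a\<bar>"

definition spacelike :: "real^3 \<Rightarrow> bool" where
  "spacelike v \<longleftrightarrow> lorentz v v > 0 \<or> v = 0"

definition timelike :: "real^3 \<Rightarrow> bool" where
  "timelike v \<longleftrightarrow> lorentz v v < 0"

definition lorentz_sphere :: "(real^3) set" where
  "lorentz_sphere = {a. lorentz a a = 1}"

section \<open>Curves\<close>

definition velocity :: "(real \<Rightarrow> real^3) \<Rightarrow> real \<Rightarrow> real^3" where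
  "velocity \<gamma> s = vector_derivative \<gamma> (at s)"

text \<open>The continuity of \<open>\<kappa>\<close> and \<open>\<tau>\<close> is automatic for smooth curves; no further
  regularity is imposed.\<close>

definition frenet_timelike_binormal ::
  "real set \<Rightarrow> (real \<Rightarrow> real^3) \<Rightarrow> (real \<Rightarrow> real^3) \<Rightarrow> (real \<Rightarrow> real^3) \<Rightarrow> (real \<Rightarrow> real^3)
    \<Rightarrow> (real \<Rightarrow> real) \<Rightarrow> (real \<Rightarrow> real) \<Rightarrow> bool" where
  "frenet_timelike_binormal I \<alpha> t n b \<kappa> \<tau> \<longleftrightarrow>
     continuous_on I \<kappa> \<and> continuous_on I \<tau> \<and>
     (\<forall>s\<in>I.
        lorentz (t s) (t s) = 1 \<and> lorentz (n s) (n s) = 1 \<and> lorentz (b s) (b s) = -1 \<and>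
        lorentz (t s) (n s) = 0 \<and> lorentz (t s) (b s) = 0 \<and> lorentz (n s) (b s) = 0 \<and>
        (\<alpha> has_vector_derivative t s) (at s) \<and>
        (t has_vector_derivative \<kappa> s *\<^sub>R n s) (at s) \<and>
        (n has_vector_derivative - \<kappa> s *\<^sub>R t s + \<tau> s *\<^sub>R b s) (at s) \<and>
        (b has_vector_derivative \<tau> s *\<^sub>R n s) (at s))"

definition darboux ::
  "(real \<Rightarrow> real^3) \<Rightarrow> (real \<Rightarrow> real^3) \<Rightarrow> (real \<Rightarrow> real) \<Rightarrow> (real \<Rightarrow> real) \<Rightarrow> real \<Rightarrow> real^3" where
  "darboux t b \<kappa> \<tau> s = \<tau> s *\<^sub>R t s - \<kappa> s *\<^sub>R b s"

definition general_helix :: "real set \<Rightarrow> (real \<Rightarrow> real) \<Rightarrow> (real \<Rightarrow> real) \<Rightarrow> bool" where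
  "general_helix I \<kappa> \<tau> \<longleftrightarrow> (\<lambda>s. \<tau> s / \<kappa> s) constant_on I"

definition involute :: "(real \<Rightarrow> real^3) \<Rightarrow> real \<Rightarrow> real \<Rightarrow> real^3" where
  "involute \<alpha> c s = \<alpha> s + (c - s) *\<^sub>R velocity \<alpha> s"

text \<open>Read as a curve in \<open>real^3\<close>, the unit tangent field is the tangent spherical indicatrix.\<close>

definition unit_tangent :: "(real \<Rightarrow> real^3) \<Rightarrow> real \<Rightarrow> real^3" where
  "unit_tangent \<gamma> s = (1 / lorentz_norm (velocity \<gamma> s)) *\<^sub>R velocity \<gamma> s"

text \<open>Signed arc length measured from the parameter value \<open>s0\<close>.\<close>

definition arc_length :: "(real \<Rightarrow> real^3) \<Rightarrow> real \<Rightarrow> real \<Rightarrow> real" where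
  "arc_length \<gamma> s0 s = (LBINT u=ereal s0..ereal s. lorentz_norm (velocity \<gamma> u))"

text \<open>The arc length parametrization of \<open>\<gamma>\<close> restricted to \<open>J\<close>; it is meaningful on
  \<open>arc_length \<gamma> s0 ` J\<close>.\<close>

definition arc_length_param :: "real set \<Rightarrow> (real \<Rightarrow> real^3) \<Rightarrow> real \<Rightarrow> real \<Rightarrow> real^3" where
  "arc_length_param J \<gamma> s0 = \<gamma> \<circ> inv_into J (arc_length \<gamma> s0)"

section \<open>Geometry of a hypersurface with a unit normal field\<close>

text \<open>A hypersurface is given by its point set \<open>M\<close> and a unit normal field \<open>\<xi>\<close>, the latter extended
  to a neighbourhood of \<open>M\<close>. For \<open>v\<close> tangent to \<open>M\<close>, the derivative of \<open>\<xi>\<close> in direction \<open>v\<close> does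
  not depend on the extension. A tangent vector \<open>v\<close> at \<open>p\<close> is the pair \<open>(p, v)\<close>.\<close>

definition tangent_bundle ::
  "(real^3) set \<Rightarrow> (real^3 \<Rightarrow> real^3) \<Rightarrow> ((real^3) \<times> (real^3)) set" where
  "tangent_bundle M \<xi> = {(p, v). p \<in> M \<and> lorentz v (\<xi> p) = 0}"

definition normal_sign :: "(real^3 \<Rightarrow> real^3) \<Rightarrow> real^3 \<Rightarrow> real" where
  "normal_sign \<xi> p = lorentz (\<xi> p) (\<xi> p)"

definition shape_operator :: "(real^3 \<Rightarrow> real^3) \<Rightarrow> real^3 \<Rightarrow> real^3 \<Rightarrow> real^3" where
  "shape_operator \<xi> p v = - frechet_derivative \<xi> (at p) v"

fun geodesic_spray :: "(real^3 \<Rightarrow> real^3) \<Rightarrow> (real^3) \<times> (real^3) \<Rightarrow> real^3" where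
  "geodesic_spray \<xi> (p, v) = (normal_sign \<xi> p * lorentz v (shape_operator \<xi> p v)) *\<^sub>R \<xi> p"

definition natural_lift :: "(real \<Rightarrow> real^3) \<Rightarrow> real \<Rightarrow> (real^3) \<times> (real^3)" where
  "natural_lift \<beta> s = (\<beta> s, velocity \<beta> s)"

text \<open>The flat covariant derivative of \<open>\<beta>'\<close> along \<open>\<beta>\<close>.\<close>

definition acceleration :: "(real \<Rightarrow> real^3) \<Rightarrow> real \<Rightarrow> real^3" where
  "acceleration \<beta> s = vector_derivative (velocity \<beta>) (at s)"

text \<open>The induced Levi-Civita connection applied to \<open>\<beta>'\<close> along \<open>\<beta>\<close>: the part of the flat
  covariant derivative tangent to the hypersurface.\<close>

definition induced_acceleration ::
  "(real^3 \<Rightarrow> real^3) \<Rightarrow> (real \<Rightarrow> real^3) \<Rightarrow> real \<Rightarrow> real^3" where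
  "induced_acceleration \<xi> \<beta> s =
     acceleration \<beta> s
       - (normal_sign \<xi> (\<beta> s) * lorentz (acceleration \<beta> s) (\<xi> (\<beta> s))) *\<^sub>R \<xi> (\<beta> s)"

definition twice_differentiable_curve_on ::
  "(real^3) set \<Rightarrow> (real \<Rightarrow> real^3) \<Rightarrow> real set \<Rightarrow> bool" where
  "twice_differentiable_curve_on M \<beta> K \<longleftrightarrow>
     (\<forall>s\<in>K. \<beta> s \<in> M \<and> \<beta> differentiable (at s) \<and> velocity \<beta> differentiable (at s))"

definition geodesic_on ::
  "(real^3) set \<Rightarrow> (real^3 \<Rightarrow> real^3) \<Rightarrow> (real \<Rightarrow> real^3) \<Rightarrow> real set \<Rightarrow> bool" where
  "geodesic_on M \<xi> \<beta> K \<longleftrightarrow>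
     twice_differentiable_curve_on M \<beta> K \<and> (\<forall>s\<in>K. induced_acceleration \<xi> \<beta> s = 0)"

definition natural_lift_integral_curve_on ::
  "(real^3) set \<Rightarrow> (real^3 \<Rightarrow> real^3) \<Rightarrow> (real \<Rightarrow> real^3) \<Rightarrow> real set \<Rightarrow> bool" where
  "natural_lift_integral_curve_on M \<xi> \<beta> K \<longleftrightarrow>
     twice_differentiable_curve_on M \<beta> K \<and>
     (\<forall>s\<in>K. natural_lift \<beta> s \<in> tangent_bundle M \<xi> \<and>
        acceleration \<beta> s = geodesic_spray \<xi> (natural_lift \<beta> s))"

definition sphere_normal :: "real^3 \<Rightarrow> real^3" where
  "sphere_normal p = p"

end

(* With \<tau> = q \<kappa> and r = sqrt |1 - q^2|, the unit tangent of the involute is n, whose velocity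
   is \<kappa> (-t + q b), of Lorentzian length \<kappa> r. Hence the indicatrix \<beta>, parametrized by its own arc
   length, has \<beta>' = (-t + q b) / r, and since q is constant \<beta>'' = ((q^2 - 1) / r^2) n = +-\<beta>. So the
   acceleration is normal to the sphere, with exactly the sign prescribed by the spray,
   -g(\<beta>', \<beta>') = (q^2 - 1) / r^2. The hypothesis on the Darboux vector only serves to exclude q^2 = 1. *)

theory Submission
  imports Defs
begin

lemma lorentz_add_left: "lorentz (x + y) z = lorentz x z + lorentz y z"
  and lorentz_add_right: "lorentz z (x + y) = lorentz z x + lorentz z y"
  and lorentz_diff_left: "lorentz (x - y) z = lorentz x z - lorentz y z"
  and lorentz_diff_right: "lorentz z (x - y) = lorentz z x - lorentz z y"
  and lorentz_minus_left: "lorentz (- x) z = - lorentz x z"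
  and lorentz_minus_right: "lorentz z (- x) = - lorentz z x"
  and lorentz_scaleR_left: "lorentz (k *\<^sub>R x) z = k * lorentz x z"
  and lorentz_scaleR_right: "lorentz z (k *\<^sub>R x) = k * lorentz z x"
  by (simp_all add: lorentz_def algebra_simps)

lemmas lorentz_bilinear =
  lorentz_add_left lorentz_add_right lorentz_diff_left lorentz_diff_right
  lorentz_minus_left lorentz_minus_right lorentz_scaleR_left lorentz_scaleR_right

lemma lorentz_commute: "lorentz x y = lorentz y x"
  by (simp add: lorentz_def)

lemma lorentz_zero_left [simp]: "lorentz 0 y = 0"
  by (simp add: lorentz_def)

lemma lorentz_norm_scaleR: "lorentz_norm (k *\<^sub>R x) = \<bar>k\<bar> * lorentz_norm x"
proof -
  have "\<bar>lorentz (k *\<^sub>R x) (k *\<^sub>R x)\<bar> = k\<^sup>2 * \<bar>lorentz x x\<bar>"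
    by (simp add: lorentz_bilinear abs_mult power2_eq_square)
  then show ?thesis
    by (simp add: lorentz_norm_def real_sqrt_mult)
qed

lemma velocity_eqI: "(\<gamma> has_vector_derivative v) (at s) \<Longrightarrow> velocity \<gamma> s = v"
  by (simp add: velocity_def vector_derivative_at)

text \<open>The fundamental theorem of calculus is applied on a compact interval and gives a
  derivative within it. Since \<open>s\<close> may lie on either side of \<open>s0\<close>, the
  interval spanned by both is enlarged inside the open set \<open>J\<close>; this makes
  \<open>s\<close> an interior point and the derivative two-sided.\<close>

lemma arc_length_has_real_derivative:
  assumes "open J" "is_interval J" "s0 \<in> J" "s \<in> J"
    and cont: "continuous_on J (\<lambda>u. lorentz_norm (velocity \<gamma> u))"
  shows "(arc_length \<gamma> s0 has_real_derivative lorentz_norm (velocity \<gamma> s)) (at s)"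
proof -
  let ?f = "\<lambda>u. lorentz_norm (velocity \<gamma> u)"
  have "min s0 s \<in> J" "max s0 s \<in> J"
    using assms by (auto simp: min_def max_def)
  then obtain d e where d: "d > 0" "cball (min s0 s) d \<subseteq> J" and e: "e > 0" "cball (max s0 s) e \<subseteq> J"
    using \<open>open J\<close> by (meson open_contains_cball)
  define l where "l = min s0 s - d"
  define h where "h = max s0 s + e"
  have "l \<in> cball (min s0 s) d" "h \<in> cball (max s0 s) e"
    using d(1) e(1) by (simp_all add: l_def h_def dist_real_def)
  then have "l \<in> J" "h \<in> J"
    using d(2) e(2) by blast+
  then have "{l..h} \<subseteq> J"
    using \<open>is_interval J\<close> by (meson atLeastAtMost_iff mem_is_interval_1_I subsetI)
  then have "continuous_on {l..h} ?f"
    using cont continuous_on_subset by blast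
  moreover have lh: "l \<le> s0" "s0 \<le> h" "l < s" "s < h"
    using d(1) e(1) by (auto simp: l_def h_def)
  ultimately have "((\<lambda>u. LBINT y=ereal s0..ereal u. ?f y) has_vector_derivative ?f s) (at s within {l..h})"
    by (intro interval_integral_FTC2) auto
  then have "(arc_length \<gamma> s0 has_vector_derivative ?f s) (at s within {l..h})"
    by (simp add: arc_length_def[abs_def])
  then show ?thesis
    using lh by (simp add: at_within_Icc_at has_real_derivative_iff_has_vector_derivative)
qed

text \<open>Continuous positive speed is what makes arc length a change of parameter with
  differentiable inverse. Nothing here depends on Frenet frames.\<close>

locale arc_length_parametrizable =
  fixes J :: "real set" and \<gamma> :: "real \<Rightarrow> real^3" and s0 :: real
  assumes open_domain: "open J" and interval_domain: "is_interval J" and base: "s0 \<in> J"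
    and cont_speed: "continuous_on J (\<lambda>u. lorentz_norm (velocity \<gamma> u))"
    and speed_pos: "\<And>u. u \<in> J \<Longrightarrow> lorentz_norm (velocity \<gamma> u) > 0"
begin

lemma deriv_arc_length:
  "s \<in> J \<Longrightarrow> (arc_length \<gamma> s0 has_real_derivative lorentz_norm (velocity \<gamma> s)) (at s)"
  using arc_length_has_real_derivative open_domain interval_domain base cont_speed by blast

lemma inj_on_arc_length: "inj_on (arc_length \<gamma> s0) J"
proof (rule linorder_inj_onI')
  fix x y assume xy: "x \<in> J" "y \<in> J" "x < y"
  then have "u \<in> J" if "x \<le> u" "u \<le> y" for u
    using that mem_is_interval_1_I[OF interval_domain] by blast
  then have "arc_length \<gamma> s0 x < arc_length \<gamma> s0 y"
    using deriv_arc_length speed_pos by (intro DERIV_pos_imp_increasing[OF xy(3)]) blast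
  then show "arc_length \<gamma> s0 x \<noteq> arc_length \<gamma> s0 y"
    by simp
qed

lemma continuous_on_arc_length: "continuous_on J (arc_length \<gamma> s0)"
  using deriv_arc_length DERIV_isCont continuous_at_imp_continuous_on by blast

text \<open>Needed for second derivatives: a formula for a velocity valid on this image can be
  differentiated only if it holds on a neighbourhood.\<close>

lemma open_arc_length_image: "open (arc_length \<gamma> s0 ` J)"
  using invariance_of_domain[OF continuous_on_arc_length open_domain inj_on_arc_length] .

text \<open>Chain rule with the derivative of the inverse function. The function \<open>f\<close> is
  arbitrary because the rule is used twice: for the indicatrix itself and for its velocity
  field.\<close>

lemma reparametrization_has_vector_derivative:
  assumes "s \<in> J" "(f has_vector_derivative F) (at s)"
  shows "((f \<circ> inv_into J (arc_length \<gamma> s0)) has_vector_derivative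
           (1 / lorentz_norm (velocity \<gamma> s)) *\<^sub>R F) (at (arc_length \<gamma> s0 s))"
proof -
  let ?g = "inv_into J (arc_length \<gamma> s0)"
  have g: "?g (arc_length \<gamma> s0 u) = u" if "u \<in> J" for u
    using that inj_on_arc_length by simp
  \<comment> \<open>This form of the inverse function theorem asks only for continuity of arc length
    on the open set \<open>J\<close> and for a left inverse there; continuity of \<open>?g\<close>
    is not a premise.\<close>
  have "(?g has_real_derivative inverse (lorentz_norm (velocity \<gamma> s))) (at (arc_length \<gamma> s0 s))"
    using deriv_arc_length[OF \<open>s \<in> J\<close>] speed_pos[OF \<open>s \<in> J\<close>]
    by (simp only: has_field_derivative_def, intro has_derivative_inverse_strong[where S = J and f = "arc_length \<gamma> s0"])
      (auto simp: assms open_domain continuous_on_arc_length g fun_eq_iff)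
  then have "(?g has_vector_derivative inverse (lorentz_norm (velocity \<gamma> s))) (at (arc_length \<gamma> s0 s))"
    by (simp add: has_real_derivative_iff_has_vector_derivative)
  from vector_diff_chain_at[OF this] show ?thesis
    using assms by (simp add: g divide_inverse)
qed

end

text \<open>The position vector extends to the identity of the whole space, which is its own
  derivative. On the sphere the spray therefore has coefficient -g(v,v).\<close>

lemma shape_operator_sphere [simp]: "shape_operator sphere_normal p v = - v"
proof -
  have "sphere_normal = id"
    by (simp add: sphere_normal_def fun_eq_iff)
  then show ?thesis
    by (simp add: shape_operator_def)
qed

theorem mainTheorem1:
  fixes \<alpha> t n b \<beta> :: "real \<Rightarrow> real^3"
    and \<kappa> \<tau> :: "real \<Rightarrow> real"
    and I J K :: "real set"
    and c s0 :: real
  assumes "open I" and "is_interval I"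
    and "frenet_timelike_binormal I \<alpha> t n b \<kappa> \<tau>"
    and "\<forall>s\<in>I. \<kappa> s > 0"
    and "(\<forall>s\<in>I. spacelike (darboux t b \<kappa> \<tau> s)) \<or> (\<forall>s\<in>I. timelike (darboux t b \<kappa> \<tau> s))"
    and "general_helix I \<kappa> \<tau>"
    and "J = I \<inter> {..<c}" and "s0 \<in> J"
    and "\<beta> = arc_length_param J (unit_tangent (involute \<alpha> c)) s0"
    and "K = arc_length (unit_tangent (involute \<alpha> c)) s0 ` J"
  shows "geodesic_on lorentz_sphere sphere_normal \<beta> K \<and>
    natural_lift_integral_curve_on lorentz_sphere sphere_normal \<beta> K"
proof -
  let ?\<gamma> = "unit_tangent (involute \<alpha> c)"
  obtain q where q: "\<And>s. s \<in> I \<Longrightarrow> \<tau> s / \<kappa> s = q"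
    using \<open>general_helix I \<kappa> \<tau>\<close> by (auto simp: general_helix_def constant_on_def)
  have \<kappa>: "\<kappa> s > 0" and \<tau>: "\<tau> s = q * \<kappa> s" if "s \<in> I" for s
    using assms(4) q[OF that] that by (auto simp: field_simps)
  have J: "open J" "is_interval J" "J \<subseteq> I" "s0 \<in> I"
    using assms by (auto intro!: is_interval_Int)
  have cont: "continuous_on I \<kappa>"
    using assms(3) by (simp add: frenet_timelike_binormal_def)
  have frame:
    "lorentz (t s) (t s) = 1" "lorentz (n s) (n s) = 1" "lorentz (b s) (b s) = -1"
    "lorentz (t s) (n s) = 0" "lorentz (t s) (b s) = 0" "lorentz (n s) (b s) = 0"
    "lorentz (n s) (t s) = 0" "lorentz (b s) (t s) = 0" "lorentz (b s) (n s) = 0"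
    if "s \<in> I" for s
    using assms(3) that lorentz_commute
    unfolding frenet_timelike_binormal_def by auto
  \<comment> \<open>With \<tau> eliminated, the derivatives of \<open>t\<close>, \<open>n\<close>
    and \<open>b\<close> all carry the factor \<kappa>, which later cancels against the speed of the
    indicatrix.\<close>
  have derivs: "(\<alpha> has_vector_derivative t s) (at s)"
    "(t has_vector_derivative \<kappa> s *\<^sub>R n s) (at s)"
    "(n has_vector_derivative \<kappa> s *\<^sub>R (q *\<^sub>R b s - t s)) (at s)"
    "(b has_vector_derivative (q * \<kappa> s) *\<^sub>R n s) (at s)"
    if "s \<in> I" for s
    using assms(3) that \<tau>[OF that]
    unfolding frenet_timelike_binormal_def by (auto simp: algebra_simps)

  \<comment> \<open>Otherwise the Darboux vector at \<open>s0\<close> is null. A null vector is not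
    timelike, and is spacelike only by the convention admitting 0; but its product with
    \<open>b\<close> is \<kappa> > 0.\<close>
  have "q\<^sup>2 \<noteq> 1"
  proof
    assume q1: "q\<^sup>2 = 1"
    let ?w = "darboux t b \<kappa> \<tau> s0"
    note s0 = frame[OF \<open>s0 \<in> I\<close>] \<tau>[OF \<open>s0 \<in> I\<close>] \<kappa>[OF \<open>s0 \<in> I\<close>]
    have "lorentz ?w ?w = (q\<^sup>2 - 1) * (\<kappa> s0)\<^sup>2"
      using s0 by (simp add: darboux_def lorentz_bilinear power2_eq_square algebra_simps)
    then have "lorentz ?w ?w = 0"
      using q1 by simp
    then have "?w = 0"
      using assms(5) \<open>s0 \<in> I\<close> by (force simp: spacelike_def timelike_def)
    moreover have "lorentz ?w (b s0) = \<kappa> s0"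
      using s0 by (simp add: darboux_def lorentz_bilinear)
    ultimately show False
      using s0 by simp
  qed
  \<comment> \<open>The Lorentzian length of q b - t, whose square g is 1 - q^2. The absolute value
    covers both causal types at once.\<close>
  define r where "r = sqrt \<bar>1 - q\<^sup>2\<bar>"
  have r: "r > 0"
    using \<open>q\<^sup>2 \<noteq> 1\<close> by (simp add: r_def)

  have inv_velocity: "velocity (involute \<alpha> c) s = ((c - s) * \<kappa> s) *\<^sub>R n s" if "s \<in> J" for s
  proof (rule velocity_eqI)
    have "s \<in> I"
      using that J by blast
    have "((\<lambda>u. \<alpha> u + (c - u) *\<^sub>R t u) has_vector_derivative ((c - s) * \<kappa> s) *\<^sub>R n s) (at s)"
      by (rule derivative_eq_intros derivs[OF \<open>s \<in> I\<close>] refl | simp)+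
    \<comment> \<open>\<open>involute\<close> uses \<open>velocity\<close> of \<alpha>, known to be
      \<open>t\<close> on \<open>I\<close> only; as \<open>I\<close> is open, the derivative carries
      over.\<close>
    then show "(involute \<alpha> c has_vector_derivative ((c - s) * \<kappa> s) *\<^sub>R n s) (at s)"
    proof (rule has_vector_derivative_transform_within_open)
      fix u assume "u \<in> I"
      then show "\<alpha> u + (c - u) *\<^sub>R t u = involute \<alpha> c u"
        by (simp add: involute_def velocity_eqI[OF derivs(1)])
    qed fact+
  qed
  have \<gamma>: "?\<gamma> s = n s" if "s \<in> J" for s
  proof -
    have "s \<in> I" "s < c"
      using that assms(7) by auto
    \<comment> \<open>Here s < c decides the sign: the unit tangent is n and not -n.\<close>
    then have "\<bar>(c - s) * \<kappa> s\<bar> = (c - s) * \<kappa> s" "(c - s) * \<kappa> s \<noteq> 0"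
      using \<kappa>[of s] by auto
    then show ?thesis
      using frame(2)[OF \<open>s \<in> I\<close>]
      by (simp add: unit_tangent_def inv_velocity[OF that] lorentz_norm_scaleR)
        (simp add: lorentz_norm_def)
  qed
  have \<gamma>': "(?\<gamma> has_vector_derivative \<kappa> s *\<^sub>R (q *\<^sub>R b s - t s)) (at s)" if "s \<in> J" for s
    using that J \<gamma>
    by (intro has_vector_derivative_transform_within_open[OF derivs(3)]) auto
  have speed: "lorentz_norm (velocity ?\<gamma> s) = \<kappa> s * r" if "s \<in> J" for s
  proof -
    have "s \<in> I"
      using that J by blast
    then show ?thesis
      using frame[OF \<open>s \<in> I\<close>] \<kappa>[OF \<open>s \<in> I\<close>]
      by (simp add: velocity_eqI[OF \<gamma>'[OF that]] lorentz_norm_scaleR)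
        (simp add: lorentz_norm_def r_def lorentz_bilinear power2_eq_square algebra_simps)
  qed
  interpret arc_length_parametrizable J ?\<gamma> s0
  proof
    have "continuous_on J (\<lambda>u. \<kappa> u * r)"
      using continuous_on_subset[OF cont \<open>J \<subseteq> I\<close>] by (intro continuous_intros)
    then show "continuous_on J (\<lambda>u. lorentz_norm (velocity ?\<gamma> u))"
      by (simp add: speed cong: continuous_on_cong)
    show "lorentz_norm (velocity ?\<gamma> u) > 0" if "u \<in> J" for u
      using that r J \<kappa> by (auto simp: speed)
  qed (use J assms(8) in auto)

  let ?g = "inv_into J (arc_length ?\<gamma> s0)"
  \<comment> \<open>The velocity of \<beta> in the old parameter: \<kappa> (q b - t) divided by the
    speed \<kappa> r.\<close>
  let ?T = "\<lambda>s. (1 / r) *\<^sub>R (q *\<^sub>R b s - t s)"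
  have \<beta>_def: "\<beta> = ?\<gamma> \<circ> ?g"
    by (simp add: assms(9) arc_length_param_def)
  have \<beta>: "\<beta> (arc_length ?\<gamma> s0 s) = n s" if "s \<in> J" for s
    using that by (simp add: \<beta>_def \<gamma> inj_on_arc_length)
  have \<beta>': "(\<beta> has_vector_derivative ?T s) (at (arc_length ?\<gamma> s0 s))" if "s \<in> J" for s
  proof -
    have "\<kappa> s > 0"
      using that J \<kappa> by blast
    then show ?thesis
      using reparametrization_has_vector_derivative[OF that \<gamma>'[OF that]]
      by (simp add: \<beta>_def speed[OF that])
  qed
  have \<beta>'': "(velocity \<beta> has_vector_derivative ((q\<^sup>2 - 1) / r\<^sup>2) *\<^sub>R n s) (at (arc_length ?\<gamma> s0 s))"
    if "s \<in> J" for s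
  proof -
    have "s \<in> I"
      using that J by blast
    \<comment> \<open>Both b' and t' are multiples of n, so constancy of \<open>q\<close> leaves no
      tangential term.\<close>
    have "(?T has_vector_derivative (1 / r) *\<^sub>R (q *\<^sub>R (q * \<kappa> s) *\<^sub>R n s - \<kappa> s *\<^sub>R n s)) (at s)"
      using derivs[OF \<open>s \<in> I\<close>]
      by (intro has_vector_derivative_diff
          bounded_linear.has_vector_derivative[OF bounded_linear_scaleR_right])
    also have "(1 / r) *\<^sub>R (q *\<^sub>R (q * \<kappa> s) *\<^sub>R n s - \<kappa> s *\<^sub>R n s) = (\<kappa> s * ((q\<^sup>2 - 1) / r)) *\<^sub>R n s"
      by (simp add: power2_eq_square algebra_simps diff_divide_distrib)
    finally have "(?T has_vector_derivative (\<kappa> s * ((q\<^sup>2 - 1) / r)) *\<^sub>R n s) (at s)" .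
    from reparametrization_has_vector_derivative[OF that this]
    have "((?T \<circ> ?g) has_vector_derivative ((q\<^sup>2 - 1) / r\<^sup>2) *\<^sub>R n s) (at (arc_length ?\<gamma> s0 s))"
      using \<kappa>[OF \<open>s \<in> I\<close>] by (simp add: speed[OF that] power2_eq_square)
    then show ?thesis
    proof (rule has_vector_derivative_transform_within_open[OF _ open_arc_length_image])
      show "(?T \<circ> ?g) x = velocity \<beta> x" if "x \<in> arc_length ?\<gamma> s0 ` J" for x
        using that by (auto simp: velocity_eqI[OF \<beta>'] inj_on_arc_length)
    qed (use that in blast)
  qed
  have curve: "twice_differentiable_curve_on lorentz_sphere \<beta> K"
    using \<beta>' \<beta>'' J frame(2)
    by (auto simp: twice_differentiable_curve_on_def assms(10) \<beta> lorentz_sphere_def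
        intro: differentiableI_vector)
  have acc: "acceleration \<beta> (arc_length ?\<gamma> s0 s) = ((q\<^sup>2 - 1) / r\<^sup>2) *\<^sub>R n s" if "s \<in> J" for s
    using \<beta>''[OF that] by (simp add: acceleration_def vector_derivative_at)
  \<comment> \<open>At \<beta> = n the unit normal is n itself, with sign 1, so subtracting the
    normal part removes the whole acceleration.\<close>
  have "geodesic_on lorentz_sphere sphere_normal \<beta> K"
    using curve J frame(2)
    by (auto simp: geodesic_on_def assms(10) induced_acceleration_def normal_sign_def
        sphere_normal_def acc \<beta> lorentz_scaleR_left)
  moreover have "natural_lift_integral_curve_on lorentz_sphere sphere_normal \<beta> K"
    unfolding natural_lift_integral_curve_on_def
  proof (intro conjI ballI curve)
    fix x assume "x \<in> K"
    then obtain s where s: "s \<in> J" and x: "x = arc_length ?\<gamma> s0 s"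
      using assms(10) by blast
    then have "s \<in> I"
      using J by blast
    have lift: "natural_lift \<beta> x = (n s, ?T s)"
      by (simp add: natural_lift_def x \<beta>[OF s] velocity_eqI[OF \<beta>'[OF s]])
    show "natural_lift \<beta> x \<in> tangent_bundle lorentz_sphere sphere_normal"
      using frame[OF \<open>s \<in> I\<close>]
      by (simp add: lift tangent_bundle_def lorentz_sphere_def sphere_normal_def lorentz_bilinear)
    \<comment> \<open>Keeping \<open>r\<close> unevaluated makes this agree with the coefficient in
      \<open>acc\<close>, without splitting on the sign of q^2 - 1.\<close>
    have "lorentz (?T s) (- ?T s) = (q\<^sup>2 - 1) / r\<^sup>2"
      using frame[OF \<open>s \<in> I\<close>] r by (simp add: lorentz_bilinear power2_eq_square field_simps)
    then show "acceleration \<beta> x = geodesic_spray sphere_normal (natural_lift \<beta> x)"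
      using frame(2)[OF \<open>s \<in> I\<close>]
      unfolding lift by (simp add: x acc[OF s] normal_sign_def sphere_normal_def)
  qed
  ultimately show ?thesis
    by blast
qed

end
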